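(* Let $A,J\in\Sigma$ be disjoint regions. Then there exists a measurable function $V:S\to\mathbb R_{\ge0}$ satisfying $$\forall s\notin A:\ PV(s)\le V(s),\qquad \forall s\in A:\ V(s)\ge1,\qquad \exists\gamma>0\ \forall s\in J:\ V(s)\le1-\gamma,$$ if and only if $$\sup_{s\in J}\mathsf P_{\delta_s}(\sigma_A<\infty)<1.$$
   Context: Setting. - $(S,\Sigma)$ is a measurable space and $P$ is a transition probability kernel on it. - $\mathsf P_{\delta_s}$ is the law on $S^\omega$ (with the product $\sigma$-algebra) of the time-homogeneous Markov chain $(\Phi_n)$ with kernel $P$ started at $s$. - The first return time is $\sigma_A=\inf\{n\ge1:\Phi_n\in A\}$, with $\inf\emptyset=\infty$. - For a measurable $V:S\to\mathbb R_{\ge0}$, the post-expectation is $PV(s)=\int_S V(u)\,P(s,du)$. *)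

theory Defs
  imports "HOL-Probability.Probability"
begin

text \<open>
  A measurable space \<open>(S, \<Sigma>)\<close> is represented by a measure \<open>M\<close> with \<open>space M = S\<close> and
  \<open>sets M = \<Sigma>\<close>; the values of \<open>M\<close> itself play no role.  A transition probability kernel is a
  function in \<open>M \<rightarrow>\<^sub>M prob_algebra M\<close>; the lemma \<open>transition_kernel_iff\<close> spells this out.
\<close>

lemma transition_kernel_iff:
  "K \<in> M \<rightarrow>\<^sub>M prob_algebra M \<longleftrightarrow>
    (\<forall>s\<in>space M. prob_space (K s) \<and> sets (K s) = sets M) \<and>
    (\<forall>B\<in>sets M. (\<lambda>s. emeasure (K s) B) \<in> borel_measurable M)"
proof
  assume K: "K \<in> M \<rightarrow>\<^sub>M prob_algebra M"
  then have "K s \<in> space (prob_algebra M)" if "s \<in> space M" for s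
    using that by (rule measurable_space)
  with K show "(\<forall>s\<in>space M. prob_space (K s) \<and> sets (K s) = sets M) \<and>
    (\<forall>B\<in>sets M. (\<lambda>s. emeasure (K s) B) \<in> borel_measurable M)"
    by (auto simp: space_prob_algebra
        intro: measurable_emeasure_kernel[OF measurable_prob_algebraD])
next
  assume "(\<forall>s\<in>space M. prob_space (K s) \<and> sets (K s) = sets M) \<and>
    (\<forall>B\<in>sets M. (\<lambda>s. emeasure (K s) B) \<in> borel_measurable M)"
  then show "K \<in> M \<rightarrow>\<^sub>M prob_algebra M"
    by (auto intro!: measurable_prob_algebraI measurable_subprob_algebra
        simp: prob_space_imp_subprob_space)
qed

definition chain_step :: "('a \<Rightarrow> 'a measure) \<Rightarrow> 'a measure \<Rightarrow> nat \<Rightarrow> (nat \<Rightarrow> 'a) \<Rightarrow> 'a measure" where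
  "chain_step K \<mu> n \<omega> = (case n of 0 \<Rightarrow> \<mu> | Suc m \<Rightarrow> K (\<omega> m))"

text \<open>
  The law on the path space \<open>PiM UNIV (\<lambda>_. M)\<close> of the time-homogeneous Markov chain with kernel
  \<open>K\<close> and initial distribution \<open>\<mu>\<close>, obtained from the Ionescu--Tulcea theorem: the \<open>n\<close>-th
  coordinate is drawn from \<open>chain_step K \<mu> n\<close> given the previous coordinates.
\<close>

definition markov_law :: "'a measure \<Rightarrow> ('a \<Rightarrow> 'a measure) \<Rightarrow> 'a measure \<Rightarrow> (nat \<Rightarrow> 'a) measure" where
  "markov_law M K \<mu> =
    projective_family.lim UNIV (Ionescu_Tulcea.CI (chain_step K \<mu>) (\<lambda>_. M)) (\<lambda>_. M)"

definition return_time :: "'a set \<Rightarrow> (nat \<Rightarrow> 'a) \<Rightarrow> enat" where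
  "return_time A \<omega> = (INF n\<in>{n. 1 \<le> n \<and> \<omega> n \<in> A}. enat n)"

definition post_expectation :: "('a \<Rightarrow> 'a measure) \<Rightarrow> ('a \<Rightarrow> real) \<Rightarrow> 'a \<Rightarrow> ennreal" where
  "post_expectation K V s = (\<integral>\<^sup>+ u. ennreal (V u) \<partial>K s)"

lemma return_time_finite_iff: "return_time A \<omega> < \<infinity> \<longleftrightarrow> (\<exists>n\<ge>1. \<omega> n \<in> A)"
  unfolding return_time_def INF_less_iff by auto

lemma return_time_finite_sets:
  assumes [measurable]: "A \<in> sets M"
  shows "{\<omega> \<in> space (PiM UNIV (\<lambda>_. M)). return_time A \<omega> < \<infinity>} \<in> sets (PiM UNIV (\<lambda>_. M))"
  unfolding return_time_finite_iff by measurable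

context
  fixes M :: "'a measure" and K :: "'a \<Rightarrow> 'a measure" and \<mu> :: "'a measure"
  assumes K: "K \<in> M \<rightarrow>\<^sub>M prob_algebra M" and \<mu>: "\<mu> \<in> space (prob_algebra M)"
begin

lemma Ionescu_Tulcea_chain_step: "Ionescu_Tulcea (chain_step K \<mu>) (\<lambda>_. M)"
proof (rule Ionescu_Tulcea.intro)
  have K': "K \<in> M \<rightarrow>\<^sub>M subprob_algebra M"
    using K by (rule measurable_prob_algebraD)
  show "chain_step K \<mu> i \<in> PiM {0..<i} (\<lambda>_. M) \<rightarrow>\<^sub>M subprob_algebra M" for i
  proof (cases i)
    case 0
    then show ?thesis
      using \<mu> by (auto simp: chain_step_def[abs_def] space_prob_algebra space_subprob_algebra
          prob_space_imp_subprob_space)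
  next
    case (Suc m)
    have "(\<lambda>\<omega>. \<omega> m) \<in> PiM {0..<i} (\<lambda>_. M) \<rightarrow>\<^sub>M M"
      using Suc by (intro measurable_component_singleton) auto
    from measurable_compose[OF this K'] Suc show ?thesis
      by (simp add: chain_step_def[abs_def])
  qed
  fix i :: nat and x
  assume x: "x \<in> space (PiM {0..<i} (\<lambda>_. M))"
  show "prob_space (chain_step K \<mu> i x)"
  proof (cases i)
    case 0
    then show ?thesis
      using \<mu> by (simp add: chain_step_def space_prob_algebra)
  next
    case (Suc m)
    with x have "x m \<in> space M"
      by (auto simp: space_PiM PiE_iff)
    from measurable_space[OF K this] Suc show ?thesis
      by (simp add: chain_step_def space_prob_algebra)
  qed
qed

interpretation IT: Ionescu_Tulcea "chain_step K \<mu>" "\<lambda>_. M"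
  by (rule Ionescu_Tulcea_chain_step)

lemma sets_markov_law: "sets (markov_law M K \<mu>) = sets (PiM UNIV (\<lambda>_. M))"
  unfolding markov_law_def by simp

lemma space_markov_law: "space (markov_law M K \<mu>) = space (PiM UNIV (\<lambda>_. M))"
  using sets_markov_law by (rule sets_eq_imp_space_eq)

lemma markov_law_prefix:
  "distr (markov_law M K \<mu>) (PiM {0..<n} (\<lambda>_. M)) (\<lambda>\<omega>. restrict \<omega> {0..<n}) =
    IT.C 0 n (\<lambda>_. undefined)"
proof -
  have "IT.up_to {0..<n} = n"
    by (metis IT.up_to_iff_Ico IT.up_to ivl_subset finite_atLeastLessThan le_antisym le_refl
        less_eq_nat.simps(1) not_le subset_refl)
  moreover have "distr (IT.C 0 n (\<lambda>_. undefined)) (PiM {0..<n} (\<lambda>_. M)) (\<lambda>\<omega>. restrict \<omega> {0..<n}) =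
      IT.C 0 n (\<lambda>_. undefined)"
    using IT.distr_C[of n n "\<lambda>_. undefined" 0] by (simp add: space_PiM)
  ultimately show ?thesis
    unfolding markov_law_def by (simp add: IT.distr_lim IT.CI_def)
qed

text \<open>
  The two lemmas below determine all finite-dimensional distributions, hence the law: the initial
  state is distributed according to \<open>\<mu>\<close>, and given the states up to time \<open>n\<close> the state at
  time \<open>n + 1\<close> is distributed according to \<open>K (\<omega> n)\<close>.
\<close>

lemma markov_law_Suc_prefix:
  "distr (markov_law M K \<mu>) (PiM {0..<Suc (Suc n)} (\<lambda>_. M)) (\<lambda>\<omega>. restrict \<omega> {0..<Suc (Suc n)}) =
    distr (markov_law M K \<mu>) (PiM {0..<Suc n} (\<lambda>_. M)) (\<lambda>\<omega>. restrict \<omega> {0..<Suc n}) \<bind>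
      (\<lambda>\<omega>. distr (K (\<omega> n)) (PiM {0..<Suc (Suc n)} (\<lambda>_. M)) (fun_upd \<omega> (Suc n)))"
proof -
  have "IT.eP (Suc n) = (\<lambda>\<omega>. distr (K (\<omega> n)) (PiM {0..<Suc (Suc n)} (\<lambda>_. M)) (fun_upd \<omega> (Suc n)))"
    by (simp add: fun_eq_iff IT.eP_def chain_step_def)
  then show ?thesis
    unfolding markov_law_prefix by (subst IT.C.simps(2)) simp
qed

lemma markov_law_initial: "distr (markov_law M K \<mu>) M (\<lambda>\<omega>. \<omega> 0) = \<mu>"
proof -
  let ?u = "\<lambda>_ :: nat. undefined :: 'a"
  have u: "?u \<in> space (PiM {0..<0::nat} (\<lambda>_. M))"
    by (simp add: space_PiM)
  have sets_\<mu>: "sets \<mu> = sets M"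
    using \<mu> by (simp add: space_prob_algebra)
  have m0: "(\<lambda>\<omega>. \<omega> 0) \<in> PiM {0..<Suc 0} (\<lambda>_. M) \<rightarrow>\<^sub>M M"
    by (intro measurable_component_singleton) auto
  have r: "(\<lambda>\<omega>. restrict \<omega> {0..<Suc 0}) \<in> markov_law M K \<mu> \<rightarrow>\<^sub>M PiM {0..<Suc 0} (\<lambda>_. M)"
    unfolding measurable_cong_sets[OF sets_markov_law refl]
    by (intro measurable_restrict_subset) auto
  have up: "fun_upd ?u 0 \<in> \<mu> \<rightarrow>\<^sub>M PiM {0..<Suc 0} (\<lambda>_. M)"
    unfolding measurable_cong_sets[OF sets_\<mu> refl]
    by (intro measurable_fun_upd[where J="{0..<0::nat}"]) (use u in auto)
  have "distr (markov_law M K \<mu>) M (\<lambda>\<omega>. \<omega> 0) =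
      distr (distr (markov_law M K \<mu>) (PiM {0..<Suc 0} (\<lambda>_. M)) (\<lambda>\<omega>. restrict \<omega> {0..<Suc 0})) M (\<lambda>\<omega>. \<omega> 0)"
    by (subst distr_distr[OF m0 r]) (simp add: comp_def)
  also have "\<dots> = distr (IT.eP 0 ?u) M (\<lambda>\<omega>. \<omega> 0)"
    unfolding markov_law_prefix
    using bind_return[OF IT.measurable_eP[of 0] u] by simp
  also have "\<dots> = distr \<mu> M (\<lambda>x. x)"
    unfolding IT.eP_def using distr_distr[OF m0 up] by (simp add: chain_step_def comp_def)
  also have "\<dots> = \<mu>"
    using sets_\<mu> by (intro distr_id2) simp
  finally show ?thesis .
qed

lemma prob_space_markov_law: "prob_space (markov_law M K \<mu>)"
proof -
  have "(\<lambda>\<omega>. \<omega> 0) \<in> markov_law M K \<mu> \<rightarrow>\<^sub>M M"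
    unfolding measurable_cong_sets[OF sets_markov_law refl]
    by (rule measurable_component_singleton) simp
  moreover have "prob_space (distr (markov_law M K \<mu>) M (\<lambda>\<omega>. \<omega> 0))"
    unfolding markov_law_initial using \<mu> by (simp add: space_prob_algebra)
  ultimately show ?thesis
    by (rule prob_space_distrD)
qed

end

end

theory Submission
  imports Defs
begin

text \<open>
  Let \<open>g s\<close> be the probability of returning to \<open>A\<close> from \<open>s\<close>, and \<open>g n s\<close> that of returning within
  \<open>n\<close> steps.  First-step analysis gives \<open>g (n + 1) s = \<integral> (if u \<in> A then 1 else g n u) P(s, du)\<close>.  The
  function \<open>V\<close> equal to \<open>1\<close> on \<open>A\<close> and to \<open>g\<close> elsewhere then satisfies \<open>PV = g = V\<close> off \<open>A\<close> by
  monotone convergence.  Conversely, any certificate \<open>V\<close> dominates every \<open>g n\<close> off \<open>A\<close> by induction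
  on \<open>n\<close>, so \<open>g \<le> V \<le> 1 - \<gamma>\<close> on \<open>J\<close>.
\<close>

section \<open>The Markov property as an integral identity\<close>

text \<open>This is \<open>markov_law_Suc_prefix\<close> tested against \<open>F\<close>: the bind
  becomes an iterated integral, and each \<open>distr\<close> is removed by a change of
  variables.\<close>

lemma nn_integral_markov_law_Suc_prefix:
  assumes K: "K \<in> M \<rightarrow>\<^sub>M prob_algebra M" and \<mu>: "\<mu> \<in> space (prob_algebra M)"
    and F: "F \<in> borel_measurable (PiM {0..<Suc (Suc n)} (\<lambda>_. M))"
  shows "(\<integral>\<^sup>+\<omega>. F (restrict \<omega> {0..<Suc (Suc n)}) \<partial>markov_law M K \<mu>) =
    (\<integral>\<^sup>+\<omega>. \<integral>\<^sup>+x. F ((restrict \<omega> {0..<Suc n})(Suc n := x)) \<partial>K (\<omega> n) \<partial>markov_law M K \<mu>)"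
proof -
  let ?L = "markov_law M K \<mu>"
  let ?M = "\<lambda>n. PiM {0..<n} (\<lambda>_. M) :: (nat \<Rightarrow> 'a) measure"
  let ?k = "\<lambda>\<omega>. distr (K (\<omega> n)) (?M (Suc (Suc n))) (fun_upd \<omega> (Suc n))"
  interpret IT: Ionescu_Tulcea "chain_step K \<mu>" "\<lambda>_. M"
    by (rule Ionescu_Tulcea_chain_step[OF K \<mu>])
  have restr: "(\<lambda>\<omega>. restrict \<omega> {0..<m}) \<in> ?L \<rightarrow>\<^sub>M ?M m" for m
    unfolding measurable_cong_sets[OF sets_markov_law[OF K \<mu>] refl]
    by (intro measurable_restrict_subset) auto
  \<comment> \<open>\<open>?k\<close> is the extension kernel of the Ionescu-Tulcea construction, so
    its measurability is inherited from there.\<close>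
  have "IT.eP (Suc n) = ?k"
    by (simp add: fun_eq_iff IT.eP_def chain_step_def)
  then have k: "?k \<in> ?M (Suc n) \<rightarrow>\<^sub>M subprob_algebra (?M (Suc (Suc n)))"
    using IT.measurable_eP[of "Suc n"] by simp
  have "(\<integral>\<^sup>+\<omega>. F (restrict \<omega> {0..<Suc (Suc n)}) \<partial>?L) =
      (\<integral>\<^sup>+\<omega>. F \<omega> \<partial>distr ?L (?M (Suc (Suc n))) (\<lambda>\<omega>. restrict \<omega> {0..<Suc (Suc n)}))"
    by (rule nn_integral_distr[symmetric, OF restr]) (use F in simp)
  also have "\<dots> = (\<integral>\<^sup>+\<omega>. \<integral>\<^sup>+y. F y \<partial>?k \<omega> \<partial>distr ?L (?M (Suc n)) (\<lambda>\<omega>. restrict \<omega> {0..<Suc n}))"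
    unfolding markov_law_Suc_prefix[OF K \<mu>]
    by (rule nn_integral_bind[OF F]) (use k in simp)
  also have "\<dots> = (\<integral>\<^sup>+\<omega>. \<integral>\<^sup>+y. F y \<partial>?k (restrict \<omega> {0..<Suc n}) \<partial>?L)"
    using measurable_compose[OF k nn_integral_measurable_subprob_algebra[OF F]]
    by (intro nn_integral_distr[OF restr]) simp
  also have "\<dots> = (\<integral>\<^sup>+\<omega>. \<integral>\<^sup>+x. F ((restrict \<omega> {0..<Suc n})(Suc n := x)) \<partial>K (\<omega> n) \<partial>?L)"
  proof (rule nn_integral_cong)
    fix \<omega> assume "\<omega> \<in> space ?L"
    then have \<omega>: "\<omega> n \<in> space M" and r: "restrict \<omega> {0..<Suc n} \<in> space (?M (Suc n))"
      using measurable_space[OF restr] by (auto simp: space_markov_law[OF K \<mu>] space_PiM)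
    have "sets (K (\<omega> n)) = sets M"
      using measurable_space[OF K \<omega>] by (simp add: space_prob_algebra)
    then have "fun_upd (restrict \<omega> {0..<Suc n}) (Suc n) \<in> K (\<omega> n) \<rightarrow>\<^sub>M ?M (Suc (Suc n))"
      by (subst measurable_cong_sets[OF _ refl])
        (auto intro!: measurable_fun_upd[where J="{0..<Suc n}"] simp: r)
    then show "(\<integral>\<^sup>+y. F y \<partial>?k (restrict \<omega> {0..<Suc n})) =
        (\<integral>\<^sup>+x. F ((restrict \<omega> {0..<Suc n})(Suc n := x)) \<partial>K (\<omega> n))"
      using F by (simp add: nn_integral_distr)
  qed
  finally show ?thesis .
qed

section \<open>First-step recursion for return probabilities\<close>

text \<open>The recursion tests only successors, never \<open>s\<close> itself, which matches
  \<open>return_time\<close> starting at time 1. The link to the path law is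
  \<open>emeasure_return_within\<close>.\<close>

fun return_within :: "('a \<Rightarrow> 'a measure) \<Rightarrow> 'a set \<Rightarrow> nat \<Rightarrow> 'a \<Rightarrow> ennreal" where
  "return_within K A 0 s = 0"
| "return_within K A (Suc n) s = (\<integral>\<^sup>+u. (if u \<in> A then 1 else return_within K A n u) \<partial>K s)"

lemma measurable_return_within:
  assumes K: "K \<in> M \<rightarrow>\<^sub>M prob_algebra M" and [measurable]: "A \<in> sets M"
  shows "return_within K A n \<in> borel_measurable M"
proof (induction n)
  case (Suc n)
  note [measurable] = Suc
  have "(\<lambda>u. if u \<in> A then 1 else return_within K A n u) \<in> borel_measurable M"
    by measurable
  from measurable_compose[OF measurable_prob_algebraD[OF K]
      nn_integral_measurable_subprob_algebra[OF this]]
  show ?case by simp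
qed simp

lemma incseq_return_within: "incseq (\<lambda>n. return_within K A n s)"
proof (rule incseq_SucI)
  show "return_within K A n s \<le> return_within K A (Suc n) s" for n
    by (induction n arbitrary: s) (auto intro!: nn_integral_mono)
qed

text \<open>Under the integral, successors in \<open>A\<close> are covered by
  \<open>1 \<le> V\<close>, the others by the induction hypothesis. The resulting bound is the
  post-expectation, which is at most \<open>V s\<close> because \<open>s\<close> lies off
  \<open>A\<close>.\<close>

lemma return_within_le_supermartingale:
  assumes K: "K \<in> M \<rightarrow>\<^sub>M prob_algebra M"
    and super: "\<And>s. s \<in> space M - A \<Longrightarrow> post_expectation K V s \<le> ennreal (V s)"
    and A: "\<And>s. s \<in> A \<Longrightarrow> 1 \<le> V s"
    and s: "s \<in> space M - A"
  shows "return_within K A n s \<le> ennreal (V s)"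
  using s
proof (induction n arbitrary: s)
  case (Suc n)
  have "space (K s) = space M"
    using measurable_space[OF K, of s] Suc.prems
    by (auto simp: space_prob_algebra dest: sets_eq_imp_space_eq)
  then have "return_within K A (Suc n) s \<le> post_expectation K V s"
    unfolding post_expectation_def return_within.simps
    by (intro nn_integral_mono) (use A Suc.IH in auto)
  also have "\<dots> \<le> ennreal (V s)"
    using super Suc.prems by blast
  finally show ?case .
qed simp

text \<open>Monotone convergence in the recursion: its limit is a fixed point, so the certificate
  built from it satisfies its inequality off \<open>A\<close> with equality.\<close>

lemma nn_integral_SUP_return_within:
  assumes K: "K \<in> M \<rightarrow>\<^sub>M prob_algebra M" and [measurable]: "A \<in> sets M" and s: "s \<in> space M"
  shows "(\<integral>\<^sup>+u. (if u \<in> A then 1 else (SUP n. return_within K A n u)) \<partial>K s) =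
    (SUP n. return_within K A n s)"
proof -
  note [measurable] = measurable_return_within[OF K]
  have [measurable_cong]: "sets (K s) = sets M"
    using measurable_space[OF K s] by (simp add: space_prob_algebra)
  have "(\<integral>\<^sup>+u. (if u \<in> A then 1 else (SUP n. return_within K A n u)) \<partial>K s) =
      (\<integral>\<^sup>+u. (SUP n. if u \<in> A then 1 else return_within K A n u) \<partial>K s)"
    by (intro nn_integral_cong) auto
  also have "\<dots> = (SUP n. return_within K A (Suc n) s)"
    unfolding return_within.simps
    by (intro nn_integral_monotone_convergence_SUP)
      (auto simp: incseq_def le_fun_def intro: incseqD[OF incseq_return_within])
  \<comment> \<open>The sequence is increasing, so the index shift leaves the supremum
    unchanged.\<close>
  also have "\<dots> = (SUP n. return_within K A n s)"
  proof (rule SUP_eq)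
    show "\<exists>j\<in>UNIV. return_within K A (Suc i) s \<le> return_within K A j s" for i
      by blast
    show "\<exists>i\<in>UNIV. return_within K A j s \<le> return_within K A (Suc i) s" for j
      using incseq_SucD[OF incseq_return_within, where i=j] by (rule bexI) simp
  qed
  finally show ?thesis .
qed

lemma return_in_space_prob_algebra: "s \<in> space M \<Longrightarrow> return M s \<in> space (prob_algebra M)"
  by (simp add: space_prob_algebra prob_space_return)

section \<open>Return probabilities on the path space\<close>

context
  fixes M :: "'a measure" and K :: "'a \<Rightarrow> 'a measure" and A :: "'a set" and s :: 'a
  assumes K: "K \<in> M \<rightarrow>\<^sub>M prob_algebra M" and A: "A \<in> sets M" and s: "s \<in> space M"
begin

text \<open>
  The integrand is the conditional probability, given the first \<open>m\<close> steps, of a return within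
  \<open>m + n\<close> steps, so the integral depends only on \<open>m + n\<close>.
\<close>

lemma nn_integral_return_shift:
  "(\<integral>\<^sup>+\<omega>. (if \<exists>i\<in>{1..Suc m}. \<omega> i \<in> A then 1 else return_within K A n (\<omega> (Suc m)))
      \<partial>markov_law M K (return M s)) =
    (\<integral>\<^sup>+\<omega>. (if \<exists>i\<in>{1..m}. \<omega> i \<in> A then 1 else return_within K A (Suc n) (\<omega> m))
      \<partial>markov_law M K (return M s))"
proof -
  let ?L = "markov_law M K (return M s)"
  let ?M = "PiM {0..<Suc (Suc m)} (\<lambda>_. M) :: (nat \<Rightarrow> 'a) measure"
  let ?F = "\<lambda>\<omega> :: nat \<Rightarrow> 'a.
    if \<exists>i\<in>{1..Suc m}. \<omega> i \<in> A then 1 else return_within K A n (\<omega> (Suc m))"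
  note [measurable] = measurable_return_within[OF K A] A
  have [measurable]: "(\<lambda>\<omega>. \<omega> i) \<in> ?M \<rightarrow>\<^sub>M M" if "i \<le> Suc m" for i
    using that by (intro measurable_component_singleton) auto
  have "Measurable.pred ?M (\<lambda>\<omega>. \<exists>i\<in>{1..Suc m}. \<omega> i \<in> A)"
    by (intro pred_intros_finite) auto
  moreover have "(\<lambda>\<omega>. return_within K A n (\<omega> (Suc m))) \<in> borel_measurable ?M"
    by measurable
  ultimately have F: "?F \<in> borel_measurable ?M"
    by (intro measurable_If) auto
  \<comment> \<open>\<open>?F\<close> reads only coordinates up to \<open>Suc m\<close>, so it does
    not see the restriction.\<close>
  have "(\<integral>\<^sup>+\<omega>. ?F \<omega> \<partial>?L) = (\<integral>\<^sup>+\<omega>. ?F (restrict \<omega> {0..<Suc (Suc m)}) \<partial>?L)"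
    by (intro nn_integral_cong) auto
  also have "\<dots> =
      (\<integral>\<^sup>+\<omega>. \<integral>\<^sup>+x. ?F ((restrict \<omega> {0..<Suc m})(Suc m := x)) \<partial>K (\<omega> m) \<partial>?L)"
    by (rule nn_integral_markov_law_Suc_prefix[OF K return_in_space_prob_algebra[OF s] F])
  also have "\<dots> =
      (\<integral>\<^sup>+\<omega>. (if \<exists>i\<in>{1..m}. \<omega> i \<in> A then 1 else return_within K A (Suc n) (\<omega> m)) \<partial>?L)"
  proof (rule nn_integral_cong)
    fix \<omega> assume "\<omega> \<in> space ?L"
    then have "\<omega> m \<in> space M"
      by (auto simp: space_markov_law[OF K return_in_space_prob_algebra[OF s]] space_PiM)
    then interpret prob_space "K (\<omega> m)"
      using measurable_space[OF K] by (auto simp: space_prob_algebra)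
    \<comment> \<open>The update touches only coordinate \<open>Suc m\<close>. After an earlier hit
      the inner integrand is constantly 1 and \<open>K (\<omega> m)\<close> has mass 1; otherwise
      the inner integral is the recursion for \<open>Suc n\<close>.\<close>
    have hit: "(\<exists>i\<in>{1..Suc m}. ((restrict \<omega> {0..<Suc m})(Suc m := x)) i \<in> A) \<longleftrightarrow>
        (\<exists>i\<in>{1..m}. \<omega> i \<in> A) \<or> x \<in> A" for x
      by (auto simp: atLeastAtMostSuc_conv)
    show "(\<integral>\<^sup>+x. ?F ((restrict \<omega> {0..<Suc m})(Suc m := x)) \<partial>K (\<omega> m)) =
        (if \<exists>i\<in>{1..m}. \<omega> i \<in> A then 1 else return_within K A (Suc n) (\<omega> m))"
      unfolding hit fun_upd_same by (simp add: emeasure_space_1)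
  qed
  finally show ?thesis .
qed

text \<open>Iterating the shift trades \<open>?W n 0\<close> for \<open>?W 0 n\<close>. The former
  is the indicator of a hit, since \<open>return_within\<close> vanishes at horizon 0; the latter
  depends only on the initial state, whose law is the point mass at \<open>s\<close>.\<close>

lemma emeasure_return_within:
  "emeasure (markov_law M K (return M s))
    {\<omega> \<in> space (markov_law M K (return M s)). \<exists>i\<in>{1..n}. \<omega> i \<in> A} = return_within K A n s"
proof -
  let ?L = "markov_law M K (return M s)"
  let ?W = "\<lambda>m n \<omega>. if \<exists>i\<in>{1..m}. \<omega> i \<in> A then 1 else return_within K A n (\<omega> m)"
  have [measurable_cong]: "sets ?L = sets (PiM UNIV (\<lambda>_. M))"
    by (rule sets_markov_law[OF K return_in_space_prob_algebra[OF s]])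
  note [measurable] = measurable_return_within[OF K A] A
  have "(\<integral>\<^sup>+\<omega>. ?W m n \<omega> \<partial>?L) = (\<integral>\<^sup>+\<omega>. ?W 0 (m + n) \<omega> \<partial>?L)" for m n
    by (induction m arbitrary: n) (simp_all only: nn_integral_return_shift add_Suc add_Suc_right add_0)
  from this[of n 0]
  have "(\<integral>\<^sup>+\<omega>. ?W n 0 \<omega> \<partial>?L) = (\<integral>\<^sup>+\<omega>. return_within K A n (\<omega> 0) \<partial>?L)"
    by simp
  also have "\<dots> = (\<integral>\<^sup>+x. return_within K A n x \<partial>distr ?L M (\<lambda>\<omega>. \<omega> 0))"
    by (rule nn_integral_distr[symmetric]) measurable
  also have "\<dots> = return_within K A n s"
    unfolding markov_law_initial[OF K return_in_space_prob_algebra[OF s]]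
    by (rule nn_integral_return[OF s]) measurable
  finally have "(\<integral>\<^sup>+\<omega>. ?W n 0 \<omega> \<partial>?L) = return_within K A n s" .
  moreover have "(\<integral>\<^sup>+\<omega>. ?W n 0 \<omega> \<partial>?L) =
      (\<integral>\<^sup>+\<omega>. indicator {\<omega> \<in> space ?L. \<exists>i\<in>{1..n}. \<omega> i \<in> A} \<omega> \<partial>?L)"
    by (intro nn_integral_cong) (auto simp: indicator_def)
  moreover have "{\<omega> \<in> space ?L. \<exists>i\<in>{1..n}. \<omega> i \<in> A} \<in> sets ?L"
    by measurable
  ultimately show ?thesis
    by simp
qed

text \<open>Continuity from below, along the increasing events of a return within \<open>n\<close>
  steps.\<close>

lemma emeasure_return_time_finite:
  "emeasure (markov_law M K (return M s))
    {\<omega> \<in> space (markov_law M K (return M s)). return_time A \<omega> < \<infinity>} =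
    (SUP n. return_within K A n s)"
proof -
  let ?L = "markov_law M K (return M s)"
  let ?B = "\<lambda>n :: nat. {\<omega> \<in> space ?L. \<exists>i\<in>{1..n}. \<omega> i \<in> A}"
  have [measurable_cong]: "sets ?L = sets (PiM UNIV (\<lambda>_. M))"
    by (rule sets_markov_law[OF K return_in_space_prob_algebra[OF s]])
  note [measurable] = A
  have "?B n \<in> sets ?L" for n
    by measurable
  moreover have "incseq ?B"
    by (fastforce simp: incseq_def)
  ultimately have "(SUP n. emeasure ?L (?B n)) = emeasure ?L (\<Union>n. ?B n)"
    by (intro SUP_emeasure_incseq) auto
  moreover have "(\<Union>n. ?B n) = {\<omega> \<in> space ?L. return_time A \<omega> < \<infinity>}"
    unfolding return_time_finite_iff by auto (metis atLeastAtMost_iff le_refl)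
  ultimately show ?thesis
    by (simp only: emeasure_return_within)
qed

end

section \<open>Certificates and the uniform bound\<close>

theorem theorem4p2:
  fixes M :: "'a measure" and P :: "'a \<Rightarrow> 'a measure" and A J :: "'a set"
  assumes "P \<in> M \<rightarrow>\<^sub>M prob_algebra M"
    and "A \<in> sets M" and "J \<in> sets M" and "A \<inter> J = {}"
  shows "(\<exists>V :: 'a \<Rightarrow> real.
            V \<in> borel_measurable M \<and>
            (\<forall>s\<in>space M. 0 \<le> V s) \<and>
            (\<forall>s\<in>space M - A. post_expectation P V s \<le> ennreal (V s)) \<and>
            (\<forall>s\<in>A. 1 \<le> V s) \<and>
            (\<exists>\<gamma>>0. \<forall>s\<in>J. V s \<le> 1 - \<gamma>))
         \<longleftrightarrow>
         (SUP s\<in>J. emeasure (markov_law M P (return M s))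
            {\<omega> \<in> space (markov_law M P (return M s)). return_time A \<omega> < \<infinity>}) < 1"
    (is "?certificate \<longleftrightarrow> ?S < 1")
proof -
  note P = assms(1) and A[measurable] = assms(2)
  define g where "g s = (SUP n. return_within P A n s)" for s
  \<comment> \<open>Disjointness enters here: certificates dominate \<open>g\<close> only off
    \<open>A\<close>, and the constructed \<open>V\<close> equals \<open>g\<close> only
    there.\<close>
  have J: "s \<in> space M - A" if "s \<in> J" for s
    using that assms(3,4) sets.sets_into_space by blast
  have S: "?S = (SUP s\<in>J. g s)"
    unfolding g_def using J by (intro SUP_cong refl emeasure_return_time_finite[OF P A]) auto
  show ?thesis
    unfolding S
  proof
    assume ?certificate
    then obtain V \<gamma> where V: "\<And>s. s \<in> space M - A \<Longrightarrow> post_expectation P V s \<le> ennreal (V s)"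
        "\<And>s. s \<in> A \<Longrightarrow> 1 \<le> V s"
      and \<gamma>: "\<gamma> > 0" "\<And>s. s \<in> J \<Longrightarrow> V s \<le> 1 - \<gamma>"
      by blast
    have "g s \<le> ennreal (1 - \<gamma>)" if "s \<in> J" for s
    proof -
      have "g s \<le> ennreal (V s)"
        unfolding g_def by (intro SUP_least return_within_le_supermartingale[OF P V J[OF that]])
      also have "\<dots> \<le> ennreal (1 - \<gamma>)"
        using \<gamma>(2)[OF that] by (rule ennreal_leI)
      finally show ?thesis .
    qed
    then have "(SUP s\<in>J. g s) \<le> ennreal (1 - \<gamma>)"
      by (rule SUP_least)
    \<comment> \<open>For \<gamma> > 1 the coercion truncates to 0, so the bound holds without a
      case split.\<close>
    also have "\<dots> < 1"
      using \<gamma>(1) by (simp add: ennreal_less_one_iff)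
    finally show "(SUP s\<in>J. g s) < 1" .
  next
    assume less: "(SUP s\<in>J. g s) < 1"
    \<comment> \<open>On \<open>A\<close> the value is 1 rather than \<open>g\<close>, which counts
      only returns from time 1 on and may be smaller there.\<close>
    define V where "V s = enn2real (if s \<in> A then 1 else g s)" for s
    \<comment> \<open>\<open>enn2real\<close> sends infinity to 0; this bound ensures that
      \<open>V\<close> loses nothing.\<close>
    have g_le: "g s \<le> 1" if "s \<in> space M" for s
      using prob_space.emeasure_le_1[OF prob_space_markov_law[OF P
            return_in_space_prob_algebra[OF that]]]
      unfolding g_def emeasure_return_time_finite[OF P A that, symmetric] .
    have V: "ennreal (V s) = (if s \<in> A then 1 else g s)" if "s \<in> space M" for s
      using g_le[OF that] by (cases "g s") (auto simp: V_def top_unique)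
    have [measurable]: "g \<in> borel_measurable M"
      unfolding g_def[abs_def] using measurable_return_within[OF P A] by measurable
    have "V \<in> borel_measurable M"
      unfolding V_def[abs_def] by measurable
    moreover have "post_expectation P V s \<le> ennreal (V s)" if "s \<in> space M - A" for s
    proof -
      have "space (P s) = space M"
        using measurable_space[OF P, of s] that
        by (auto simp: space_prob_algebra dest: sets_eq_imp_space_eq)
      then have "post_expectation P V s = (\<integral>\<^sup>+u. (if u \<in> A then 1 else g u) \<partial>P s)"
        unfolding post_expectation_def by (intro nn_integral_cong) (simp add: V)
      also have "\<dots> = g s"
        unfolding g_def using that by (intro nn_integral_SUP_return_within[OF P A]) simp
      finally show ?thesis
        using that by (simp add: V)
    qed
    \<comment> \<open>The witness is \<gamma> = 1 - \<open>r\<close>. An empty \<open>J\<close> fits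
      in: its supremum is 0, so \<open>r\<close> is 0.\<close>
    moreover obtain r where r: "(SUP s\<in>J. g s) = ennreal r" "0 \<le> r" "r < 1"
      using less by (cases "SUP s\<in>J. g s") (auto simp: ennreal_less_one_iff)
    have "V s \<le> 1 - (1 - r)" if "s \<in> J" for s
    proof -
      have "ennreal (V s) \<le> ennreal r"
        unfolding r(1)[symmetric] using J[OF that] that by (simp add: V SUP_upper)
      then show ?thesis
        using r(2) by simp
    qed
    with r(3) have "\<exists>\<gamma>>0. \<forall>s\<in>J. V s \<le> 1 - \<gamma>"
      by (intro exI[of _ "1 - r"]) auto
    ultimately show ?certificate
      by (intro exI[of _ V]) (auto simp: V_def)
  qed
qed

end
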